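(* Let $q$ be a prime power, let $n\ge k\ge1$ be integers, and let $\mathcal{C}$ be a minimal nondegenerate $[n,k,d]_q$ code. If $\mathcal{C}$ is not constant-weight, then $$n-k+1>\frac{n(q^k-q^{k-1})}{q^k-1}$$ and $$d\le\left\lfloor\frac{n(q-1)q^{k-2}\,[n-1-q(k-1)]}{n(q^{k-1}-1)-(k-1)(q^k-1)}\right\rfloor .$$ In particular, $q^{k-2}n^2-Bn+C\ge 0$, where $$B=q^{k-2}+(k-1)(2q^{k-1}-1)+\frac{q^{k-1}-1}{q-1},\qquad C=(k-1)^2(q^k-1)+\frac{(k-1)(q^k-1)}{q-1}.$$
   Context: For $v\in\mathbb{F}_q^n$, the support is $\sigma(v)=\{i : v_i\ne 0\}$ and the weight is $\omega(v)=|\sigma(v)|$. An $[n,k,d]_q$ code is an $\mathbb{F}_q$-linear subspace $\mathcal{C}\subseteq\mathbb{F}_q^n$ of dimension $k\ge1$ with minimum distance $d=\min\{\omega(c): c\in\mathcal{C},\ c\neq 0\}$. It is nondegenerate if there is no coordinate $i$ with $c_i=0$ for all $c\in\mathcal{C}$. It is constant-weight if all its nonzero codewords have the same weight. A nonzero codeword $c\in\mathcal{C}$ is minimal if every $c'\in\mathcal{C}$ with $\sigma(c')\subseteq\sigma(c)$ is a scalar multiple of $c$; the code is minimal if all its nonzero codewords are minimal. *)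

theory Defs
  imports "HOL-Analysis.Cartesian_Space"
begin

(* The field F_q is a finite field type 'a with q = CARD('a), and F_q^n is 'a ^ 'n with
   n = CARD('n); vec.subspace and vec.dim are taken over the field 'a. *)

definition supp :: "'a::field ^ 'n \<Rightarrow> 'n set" where
  "supp v = {i. v $ i \<noteq> 0}"

definition weight :: "'a::field ^ 'n \<Rightarrow> nat" where
  "weight v = card (supp v)"

definition min_distance :: "('a::{field,finite} ^ 'n) set \<Rightarrow> nat" where
  "min_distance \<C> = Min {weight c | c. c \<in> \<C> \<and> c \<noteq> 0}"

definition linear_code :: "nat \<Rightarrow> nat \<Rightarrow> nat \<Rightarrow> nat \<Rightarrow> ('a::{field,finite} ^ 'n) set \<Rightarrow> bool" where
  "linear_code q n k d \<C> \<longleftrightarrow>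
     q = CARD('a) \<and> n = CARD('n) \<and> vec.subspace \<C> \<and> k \<ge> 1 \<and> vec.dim \<C> = k \<and> d = min_distance \<C>"

definition nondegenerate :: "('a::field ^ 'n) set \<Rightarrow> bool" where
  "nondegenerate \<C> \<longleftrightarrow> \<not> (\<exists>i. \<forall>c\<in>\<C>. c $ i = 0)"

definition constant_weight :: "('a::field ^ 'n) set \<Rightarrow> bool" where
  "constant_weight \<C> \<longleftrightarrow>
     (\<forall>c\<in>\<C>. \<forall>c'\<in>\<C>. c \<noteq> 0 \<longrightarrow> c' \<noteq> 0 \<longrightarrow> weight c = weight c')"

definition minimal_codeword :: "('a::field ^ 'n) set \<Rightarrow> 'a ^ 'n \<Rightarrow> bool" where
  "minimal_codeword \<C> c \<longleftrightarrow>
     c \<in> \<C> \<and> c \<noteq> 0 \<and> (\<forall>c'\<in>\<C>. supp c' \<subseteq> supp c \<longrightarrow> (\<exists>a. c' = a *s c))"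

definition minimal_code :: "('a::field ^ 'n) set \<Rightarrow> bool" where
  "minimal_code \<C> \<longleftrightarrow> (\<forall>c\<in>\<C>. c \<noteq> 0 \<longrightarrow> minimal_codeword \<C> c)"

end

(* Let q be the size of the field. In a minimal code, the codewords supported inside the support
   of c are the multiples of c, and each of the n - weight c vanishing conditions divides the number
   of codewords by at most q; hence weight c <= M = n - k + 1. If the code is not constant-weight,
   the average weight is smaller than M. Summing (weight c - d) (M - weight c) >= 0 over the nonzero
   codewords, with the exact first moment of the weights and a lower bound for the second one, gives
   the bound on d. The quadratic inequality follows by inserting d >= (k - 1) (q - 1) + 1, which is
   Jamison's bound for affine blocking sets: a product of weight c - 1 affine forms in k - 1
   variables that vanishes everywhere except at the origin has degree at least (k - 1) (q - 1). *)

theory Submission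
  imports Defs "HOL-Computational_Algebra.Polynomial"
begin

section \<open>Sizes of subspaces and of their coordinate sections\<close>

lemma card_subspace_extend:
  fixes S :: "('a::{field,finite} ^ 'n) set"
  assumes "vec.subspace S" and "b \<notin> S"
  shows "card {s + a *s b | s a. s \<in> S} = CARD('a) * card S"
proof -
  have inj: "inj_on (\<lambda>(s, a). s + a *s b) (S \<times> UNIV)"
  proof (rule inj_onI, clarsimp)
    fix s a s' a' assume *: "s \<in> S" "s' \<in> S" "s + a *s b = s' + a' *s b"
    then have eq: "(a - a') *s b = s' - s" by (simp add: vec.scale_left_diff_distrib algebra_simps)
    have "a = a'"
    proof (rule ccontr)
      assume "a \<noteq> a'"
      then have "b = inverse (a - a') *s (s' - s)" unfolding eq[symmetric] by simp
      with * assms show False by (simp add: vec.subspace_diff vec.subspace_scale)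
    qed
    with * show "s = s' \<and> a = a'" by simp
  qed
  have "{s + a *s b | s a. s \<in> S} = (\<lambda>(s, a). s + a *s b) ` (S \<times> UNIV)" by auto
  then show ?thesis by (simp add: card_image[OF inj] card_cartesian_product mult.commute)
qed

lemma card_span_independent:
  fixes B :: "('a::{field,finite} ^ 'n) set"
  assumes "vec.independent B"
  shows "card (vec.span B) = CARD('a) ^ card B"
proof -
  have "finite B" by simp
  then show ?thesis using assms
  proof (induction B)
    case empty
    then show ?case by simp
  next
    case (insert b B)
    then have b: "b \<notin> vec.span B" and B: "vec.independent B"
      by (auto simp: vec.independent_insert split: if_splits)
    have "vec.span (insert b B) = {s + a *s b | s a. s \<in> vec.span B}"
    proof (intro equalityI subsetI)
      fix x assume "x \<in> vec.span (insert b B)"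
      then obtain k where "x - k *s b \<in> vec.span B" by (auto simp: vec.span_insert)
      moreover have "x = (x - k *s b) + k *s b" by simp
      ultimately show "x \<in> {s + a *s b | s a. s \<in> vec.span B}" by blast
    next
      fix x assume "x \<in> {s + a *s b | s a. s \<in> vec.span B}"
      then obtain s a where "x = s + a *s b" "s \<in> vec.span B" by blast
      then have "x - a *s b \<in> vec.span B" by simp
      then show "x \<in> vec.span (insert b B)" unfolding vec.span_insert by blast
    qed
    then show ?case
      using card_subspace_extend[OF vec.subspace_span b] insert B by simp
  qed
qed

lemma card_subspace:
  fixes S :: "('a::{field,finite} ^ 'n) set"
  assumes "vec.subspace S"
  shows "card S = CARD('a) ^ vec.dim S"
proof -
  obtain B where "B \<subseteq> S" "vec.independent B" "S \<subseteq> vec.span B" "card B = vec.dim S"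
    using vec.basis_exists by metis
  moreover then have "vec.span B = S"
    using assms vec.span_minimal by blast
  ultimately show ?thesis using card_span_independent by metis
qed

lemma subspace_coordinate_zero:
  fixes S :: "('a::field ^ 'n) set"
  assumes "vec.subspace S"
  shows "vec.subspace {c \<in> S. c $ i = 0}"
  using assms by (auto simp: vec.subspace_def)

text \<open>Subtracting a suitable multiple of \<open>b\<close> from any vector of \<open>S\<close>
  makes coordinate \<open>i\<close> vanish, so \<open>S\<close> is its section at \<open>i\<close>
  extended by \<open>b\<close>.\<close>

lemma card_coordinate_zero:
  fixes S :: "('a::{field,finite} ^ 'n) set"
  assumes S: "vec.subspace S" and b: "b \<in> S" "b $ i \<noteq> 0"
  shows "card S = CARD('a) * card {c \<in> S. c $ i = 0}"
proof -
  let ?H = "{c \<in> S. c $ i = 0}"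
  have "S = {s + a *s b | s a. s \<in> ?H}"
  proof (intro equalityI subsetI)
    fix c assume "c \<in> S"
    then have "c - (c $ i / b $ i) *s b \<in> ?H"
      using S b by (simp add: vec.subspace_diff vec.subspace_scale)
    then show "c \<in> {s + a *s b | s a. s \<in> ?H}"
      by (metis (mono_tags, lifting) diff_add_cancel mem_Collect_eq)
  qed (use S b in \<open>auto intro: vec.subspace_add vec.subspace_scale\<close>)
  then show ?thesis
    using card_subspace_extend[OF subspace_coordinate_zero[OF S], of b i] b by simp
qed

lemma card_coordinate_zero_ge:
  fixes S :: "('a::{field,finite} ^ 'n) set"
  assumes S: "vec.subspace S"
  shows "card S \<le> CARD('a) * card {c \<in> S. c $ i = 0}"
proof (cases "\<exists>b\<in>S. b $ i \<noteq> 0")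
  case True
  then obtain b where "b \<in> S" "b $ i \<noteq> 0" by blast
  from card_coordinate_zero[OF S this] show ?thesis by simp
next
  case False
  then have "{c \<in> S. c $ i = 0} = S" by auto
  then show ?thesis by simp
qed

lemma card_coordinates_zero_ge:
  fixes S :: "('a::{field,finite} ^ 'n) set"
  assumes S: "vec.subspace S" and "finite Z"
  shows "card S \<le> CARD('a) ^ card Z * card {c \<in> S. \<forall>i\<in>Z. c $ i = 0}"
  using \<open>finite Z\<close>
proof (induction Z)
  case empty
  then show ?case by simp
next
  case (insert j Z)
  let ?T = "{c \<in> S. \<forall>i\<in>Z. c $ i = 0}"
  have "vec.subspace ?T" using S by (auto simp: vec.subspace_def)
  from card_coordinate_zero_ge[OF this, of j]
  have "card ?T \<le> CARD('a) * card {c \<in> S. \<forall>i\<in>insert j Z. c $ i = 0}"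
    by (simp add: conj_ac)
  then have "CARD('a) ^ card Z * card ?T
      \<le> CARD('a) ^ card Z * (CARD('a) * card {c \<in> S. \<forall>i\<in>insert j Z. c $ i = 0})"
    by (rule mult_le_mono2)
  with insert.IH have "card S \<le> \<dots>" by (rule le_trans)
  with insert.hyps show ?case by (simp add: mult.assoc mult.left_commute)
qed

lemma card_field_ge_2: "2 \<le> CARD('a::{field,finite})"
proof -
  have "card {0, 1 :: 'a} \<le> CARD('a)" by (intro card_mono) auto
  then show ?thesis by simp
qed

lemma weight_minimal_codeword_le:
  fixes \<C> :: "('a::{field,finite} ^ 'n) set"
  assumes S: "vec.subspace \<C>" and c: "minimal_codeword \<C> c"
  shows "weight c + vec.dim \<C> \<le> CARD('n) + 1"
proof -
  let ?Z = "- supp c"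
  \<comment> \<open>Vanishing on \<open>?Z\<close> means having support inside
    \<open>supp c\<close>; minimality leaves only the multiples of \<open>c\<close>.\<close>
  have "{c' \<in> \<C>. \<forall>i\<in>?Z. c' $ i = 0} \<subseteq> range (\<lambda>a. a *s c)"
    using c by (auto simp: minimal_codeword_def supp_def)
  then have "card {c' \<in> \<C>. \<forall>i\<in>?Z. c' $ i = 0} \<le> CARD('a)"
    by (meson card_image_le card_mono finite le_trans)
  then have "CARD('a) ^ vec.dim \<C> \<le> CARD('a) ^ card ?Z * CARD('a)"
    using card_coordinates_zero_ge[OF S, of ?Z] unfolding card_subspace[OF S]
    by (meson finite le_trans mult_le_mono2)
  \<comment> \<open>The factor \<open>CARD('a)\<close> for the multiples of \<open>c\<close> becomes
    the \<open>+ 1\<close> of the claim.\<close>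
  then have "CARD('a) ^ vec.dim \<C> \<le> CARD('a) ^ Suc (card ?Z)" by (simp add: mult.commute)
  then have "vec.dim \<C> \<le> Suc (card ?Z)"
    using card_field_ge_2[where 'a='a] by (intro power_le_imp_le_exp) auto
  moreover have "card ?Z + card (supp c) = CARD('n)"
    by (simp add: Compl_eq_Diff_UNIV card_Diff_subset card_mono)
  ultimately show ?thesis by (simp add: weight_def)
qed

section \<open>The polynomial method: a lower bound for the weights\<close>

text \<open>For positive \<open>e\<close>, multiplication by a nonzero \<open>y\<close> permutes the
  field and scales the sum by \<open>y ^ e\<close>. As \<open>e < CARD('a) - 1\<close>, some such
  \<open>y\<close> is not a root of X^e - 1, which forces the sum to be 0.\<close>

lemma sum_powers_field_eq_0:
  assumes "e < CARD('a) - 1"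
  shows "(\<Sum>x\<in>(UNIV::'a::{field,finite} set). x ^ e) = 0"
proof (cases "e = 0")
  case True
  \<comment> \<open>All summands are 1, also at \<open>x = 0\<close>. Translation by 1 permutes the
    field, so adding up that many ones gives 0.\<close>
  have "(\<Sum>x\<in>(UNIV::'a set). x) = (\<Sum>x\<in>(UNIV::'a set). x + 1)"
    by (rule sum.reindex_bij_witness[of _ "\<lambda>x. x + 1" "\<lambda>x. x - 1"]) auto
  then show ?thesis using True by (simp add: sum.distrib)
next
  case False
  let ?p = "monom 1 e - 1 :: 'a poly"
  have deg: "degree ?p \<le> e"
    by (intro degree_diff_le) (auto simp: degree_monom_eq)
  have "coeff ?p e = 1" using False by simp
  then have "?p \<noteq> 0" by (metis coeff_0 zero_neq_one)
  then have "card {x. poly ?p x = 0} \<le> e"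
    using card_poly_roots_bound deg le_trans by blast
  then have "card {x. poly ?p x = 0} < card (UNIV - {0 :: 'a})"
    using assms by (simp add: card_Diff_subset)
  then have "\<not> UNIV - {0 :: 'a} \<subseteq> {x. poly ?p x = 0}"
    by (meson card_mono finite leD)
  then obtain y :: 'a where y: "y \<noteq> 0" "y ^ e \<noteq> 1" by (auto simp: poly_monom)
  have "(\<Sum>x\<in>(UNIV::'a set). x ^ e) = (\<Sum>x\<in>(UNIV::'a set). (y * x) ^ e)"
    by (rule sum.reindex_bij_witness[of _ "\<lambda>x. y * x" "\<lambda>x. x / y"]) (use y in auto)
  also have "\<dots> = y ^ e * (\<Sum>x\<in>(UNIV::'a set). x ^ e)"
    by (simp add: power_mult_distrib sum_distrib_left)
  finally show ?thesis using y by simp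
qed

text \<open>The polynomial is expanded into monomials; each has degree less than \<open>(q - 1) * card J\<close>,
  so it has a variable of exponent less than \<open>q - 1\<close>, and summing over that variable gives 0.\<close>
lemma sum_prod_affine_eq_0:
  fixes t :: "'i \<Rightarrow> 'j \<Rightarrow> 'a::{field,finite}" and s :: "'i \<Rightarrow> 'a"
  assumes "finite I" and "finite J" and small: "card I < card J * (CARD('a) - 1)"
  shows "(\<Sum>u\<in>PiE J (\<lambda>_. UNIV). \<Prod>i\<in>I. s i + (\<Sum>j\<in>J. u j * t i j)) = 0"
proof -
  \<comment> \<open>The constant term gets the extra index \<open>None\<close> with variable 1. Each
    factor is then a plain sum over \<open>J'\<close>, and the product expands over choice functions
    \<open>f\<close>.\<close>
  define J' where "J' = insert None (Some ` J)"
  define r where "r i o' = (case o' of None \<Rightarrow> s i | Some j \<Rightarrow> t i j)" for i o'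
  define m where "m u o' = (case o' of None \<Rightarrow> 1 | Some j \<Rightarrow> u j)" for u :: "'j \<Rightarrow> 'a" and o'
  have J': "finite J'" using assms by (simp add: J'_def)
  have aff: "s i + (\<Sum>j\<in>J. u j * t i j) = (\<Sum>o'\<in>J'. m u o' * r i o')" for u i
    using assms by (simp add: J'_def r_def m_def sum.reindex)
  have mon: "(\<Prod>i\<in>I. m u (f i)) = (\<Prod>j\<in>J. u j ^ card {i\<in>I. f i = Some j})"
    if f: "f \<in> PiE I (\<lambda>_. J')" for u f
  proof -
    have "(\<Prod>i\<in>I. m u (f i)) = (\<Prod>o'\<in>J'. \<Prod>i\<in>{i\<in>I. f i = o'}. m u (f i))"
      using prod.group[OF \<open>finite I\<close> J', of f "\<lambda>i. m u (f i)"] f by fastforce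
    also have "\<dots> = (\<Prod>o'\<in>J'. m u o' ^ card {i\<in>I. f i = o'})"
      by (intro prod.cong) auto
    also have "\<dots> = (\<Prod>j\<in>J. u j ^ card {i\<in>I. f i = Some j})"
      using assms by (simp add: J'_def m_def prod.reindex)
    finally show ?thesis .
  qed
  have zero: "(\<Sum>u\<in>PiE J (\<lambda>_. UNIV :: 'a set). \<Prod>j\<in>J. u j ^ card {i\<in>I. f i = Some j}) = 0" for f
  proof -
    \<comment> \<open>The exponents are sizes of disjoint subsets of \<open>I\<close>, so they add
      up to at most \<open>card I\<close>.\<close>
    have "\<exists>j\<in>J. card {i\<in>I. f i = Some j} < CARD('a) - 1"
    proof (rule ccontr)
      assume "\<not> ?thesis"
      then have "card J * (CARD('a) - 1) \<le> (\<Sum>j\<in>J. card {i\<in>I. f i = Some j})"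
        by (metis (no_types, lifting) not_less of_nat_id sum_bounded_below)
      also have "\<dots> = card (\<Union>j\<in>J. {i\<in>I. f i = Some j})"
        using assms by (subst card_UN_disjoint) auto
      also have "\<dots> \<le> card I" using assms by (intro card_mono) auto
      finally show False using small by simp
    qed
    \<comment> \<open>Summing a monomial over all \<open>u\<close> factors into one power sum per
      variable.\<close>
    then have "(\<Prod>j\<in>J. \<Sum>x\<in>(UNIV::'a set). x ^ card {i\<in>I. f i = Some j}) = 0"
      using \<open>finite J\<close> sum_powers_field_eq_0 by (intro prod_zero) auto
    then show ?thesis using \<open>finite J\<close> by (subst (asm) prod_sum_PiE) simp_all
  qed
  have "(\<Sum>u\<in>PiE J (\<lambda>_. UNIV). \<Prod>i\<in>I. s i + (\<Sum>j\<in>J. u j * t i j)) =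
      (\<Sum>u\<in>PiE J (\<lambda>_. UNIV). \<Sum>f\<in>PiE I (\<lambda>_. J'). (\<Prod>i\<in>I. r i (f i)) *
        (\<Prod>j\<in>J. u j ^ card {i\<in>I. f i = Some j}))"
  proof (intro sum.cong refl)
    fix u :: "'j \<Rightarrow> 'a"
    have "(\<Prod>i\<in>I. s i + (\<Sum>j\<in>J. u j * t i j)) =
        (\<Sum>f\<in>PiE I (\<lambda>_. J'). \<Prod>i\<in>I. m u (f i) * r i (f i))"
      unfolding aff using \<open>finite I\<close> J' by (rule prod_sum_PiE)
    then show "(\<Prod>i\<in>I. s i + (\<Sum>j\<in>J. u j * t i j)) = (\<Sum>f\<in>PiE I (\<lambda>_. J').
        (\<Prod>i\<in>I. r i (f i)) * (\<Prod>j\<in>J. u j ^ card {i\<in>I. f i = Some j}))"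
      by (simp add: prod.distrib mon mult.commute cong: sum.cong)
  qed
  also have "\<dots> = (\<Sum>f\<in>PiE I (\<lambda>_. J'). (\<Prod>i\<in>I. r i (f i)) *
      (\<Sum>u\<in>PiE J (\<lambda>_. UNIV). \<Prod>j\<in>J. u j ^ card {i\<in>I. f i = Some j}))"
    by (subst sum.swap) (simp add: sum_distrib_left)
  finally show ?thesis by (simp add: zero)
qed

text \<open>Subtracting multiples of \<open>c\<close> makes all basis vectors other than \<open>c\<close> vanish at a coordinate
  \<open>i0\<close> of \<open>supp c\<close>, so that this coordinate contributes no degree: it accounts for the \<open>+ 1\<close>.\<close>
lemma weight_minimal_code_ge:
  fixes \<C> :: "('a::{field,finite} ^ 'n) set"
  assumes S: "vec.subspace \<C>" and min: "minimal_code \<C>" and c: "c \<in> \<C>" "c \<noteq> 0"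
  shows "(vec.dim \<C> - 1) * (CARD('a) - 1) + 1 \<le> weight c"
proof (rule ccontr)
  assume less: "\<not> ?thesis"
  from c obtain i0 where i0: "c $ i0 \<noteq> 0" by (auto simp: vec_eq_iff)
  obtain B where B: "{c} \<subseteq> B" "B \<subseteq> \<C>" "vec.independent B" "\<C> \<subseteq> vec.span B"
    using vec.maximal_independent_subset_extend[of "{c}" \<C>] c by auto
  have cardB: "card B = vec.dim \<C>" using B by (intro vec.basis_card_eq_dim)
  define J where "J = B - {c}"
  define I where "I = supp c - {i0}"
  define w where "w b = b - (b $ i0 / c $ i0) *s c" for b
  \<comment> \<open>The coordinates of \<open>v u\<close> are affine forms in the
    \<open>card J\<close> variables \<open>u b\<close>. The origin gives \<open>- c\<close>, and the
    coordinate \<open>i0\<close> is the same for all \<open>u\<close>.\<close>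
  define v where "v u = (\<Sum>b\<in>J. u b *s w b) - c" for u
  have J: "J \<subseteq> \<C>" "c \<notin> J" "insert c J = B" using B by (auto simp: J_def)
  have cardJ: "card J = vec.dim \<C> - 1" using B cardB by (simp add: J_def)
  have w: "w b \<in> \<C>" if "b \<in> J" for b
    using that J c S unfolding w_def by (auto intro!: vec.subspace_diff vec.subspace_scale)
  have v: "v u \<in> \<C>" for u
    using w c S unfolding v_def by (auto intro!: vec.subspace_diff vec.subspace_sum vec.subspace_scale)
  have v_eq: "v u = (\<Sum>b\<in>J. u b *s b) - ((\<Sum>b\<in>J. u b * (b $ i0 / c $ i0)) + 1) *s c" for u
    unfolding v_def w_def
    by (simp only: vec.scale_right_diff_distrib vec.scale_scale sum_subtractf vec.scale_sum_left
      vec.scale_left_distrib vec.scale_one diff_diff_eq)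
  have v_i0: "v u $ i0 = - c $ i0" for u
    using i0 by (simp add: v_def w_def sum_component)
  have vanish: "(\<Prod>i\<in>I. v u $ i) = 0" if b: "b \<in> J" "u b \<noteq> 0" for u b
  proof -
    \<comment> \<open>Otherwise minimality of \<open>v u\<close> makes \<open>c\<close> a multiple
      of it, which a nonzero coefficient \<open>u b\<close> excludes by independence of
      \<open>B\<close>.\<close>
    have "\<not> supp c \<subseteq> supp (v u)"
    proof
      assume "supp c \<subseteq> supp (v u)"
      moreover have "v u \<noteq> 0" using v_i0[of u] i0 by auto
      ultimately obtain a where a: "c = a *s v u"
        using min v c by (metis minimal_code_def minimal_codeword_def)
      then have "a \<noteq> 0" using c by auto
      with a have "v u = inverse a *s c" by (simp add: vec.scale_scale[symmetric])
      then have "(\<Sum>b\<in>J. u b *s b) =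
          (inverse a + ((\<Sum>b\<in>J. u b * (b $ i0 / c $ i0)) + 1)) *s c"
        unfolding v_eq by (simp only: diff_eq_eq vec.scale_left_distrib)
      then obtain r where r: "(\<Sum>b\<in>J. u b *s b) = r *s c" by blast
      define u' where "u' x = (if x = c then - r else u x)" for x
      have "(\<Sum>x\<in>B. u' x *s x) = - r *s c + (\<Sum>x\<in>J. u' x *s x)"
        unfolding J(3)[symmetric] using J(2) by (simp add: u'_def)
      also have "(\<Sum>x\<in>J. u' x *s x) = (\<Sum>x\<in>J. u x *s x)"
        using J(2) by (intro sum.cong) (auto simp: u'_def)
      finally have "(\<Sum>x\<in>B. u' x *s x) = 0" by (simp add: r)
      then have "u' b = 0" using B b(1) J by (auto simp: vec.independent_explicit)
      with b J(2) show False by (cases "b = c") (auto simp: u'_def)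
    qed
    then obtain i where "i \<in> supp c" "v u $ i = 0" by (auto simp: supp_def)
    moreover from this have "i \<noteq> i0" using v_i0[of u] i0 by auto
    ultimately show ?thesis by (auto simp: I_def)
  qed
  have "card I = weight c - 1" using i0 by (simp add: I_def weight_def supp_def)
  moreover have "weight c > 0" using i0 by (auto simp: weight_def supp_def card_gt_0_iff)
  ultimately have "card I < card J * (CARD('a) - 1)" using less cardJ by simp
  then have "(\<Sum>u\<in>PiE J (\<lambda>_. UNIV). \<Prod>i\<in>I. - c $ i + (\<Sum>b\<in>J. u b * w b $ i)) = 0"
    by (intro sum_prod_affine_eq_0) auto
  then have "0 = (\<Sum>u\<in>PiE J (\<lambda>_. UNIV). \<Prod>i\<in>I. v u $ i)"
    by (simp add: v_def sum_component)
  \<comment> \<open>By \<open>vanish\<close> only the origin contributes, and its product of entries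
    of \<open>- c\<close> over \<open>I\<close> is nonzero.\<close>
  also have "\<dots> = (\<Sum>u\<in>{\<lambda>x\<in>J. 0}. \<Prod>i\<in>I. v u $ i)"
  proof (rule sum.mono_neutral_right)
    show "\<forall>u\<in>PiE J (\<lambda>_. UNIV) - {\<lambda>x\<in>J. 0}. (\<Prod>i\<in>I. v u $ i) = 0"
    proof
      fix u assume u: "u \<in> PiE J (\<lambda>_. UNIV) - {\<lambda>x\<in>J. 0 :: 'a}"
      then have "\<exists>b\<in>J. u b \<noteq> 0" by (fastforce simp: PiE_def extensional_def fun_eq_iff)
      then show "(\<Prod>i\<in>I. v u $ i) = 0" using vanish by blast
    qed
  qed (auto intro: finite_PiE)
  also have "\<dots> = (\<Prod>i\<in>I. - c $ i)" by (simp add: v_def)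
  finally show False by (auto simp: I_def supp_def)
qed

section \<open>First and second moments of the weights\<close>

lemma weight_eq_sum: "real (weight c) = (\<Sum>i\<in>UNIV. of_bool (c $ i \<noteq> 0))"
  by (simp add: weight_def supp_def sum_of_bool_eq)

text \<open>Double counting by coordinates: nondegeneracy makes each coordinate vanish on exactly
  the fraction \<open>1 / CARD('a)\<close> of the code.\<close>

lemma sum_weight:
  fixes \<C> :: "('a::{field,finite} ^ 'n) set"
  assumes S: "vec.subspace \<C>" and nd: "nondegenerate \<C>"
  shows "(\<Sum>c\<in>\<C>. real (weight c)) = real CARD('n) * (real (card \<C>) - real (card \<C>) / real CARD('a))"
proof -
  have count: "(\<Sum>c\<in>\<C>. of_bool (c $ i \<noteq> 0)) = real (card \<C>) - real (card \<C>) / real CARD('a)" for i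
  proof -
    obtain b where "b \<in> \<C>" "b $ i \<noteq> 0" using nd by (auto simp: nondegenerate_def)
    from card_coordinate_zero[OF S this]
    have "real (card {c\<in>\<C>. c $ i = 0}) = real (card \<C>) / real CARD('a)" by simp
    moreover have "(\<Sum>c\<in>\<C>. of_bool (c $ i \<noteq> 0)) = (\<Sum>c\<in>\<C>. 1 - of_bool (c $ i = 0) :: real)"
      by (intro sum.cong) auto
    moreover have "(\<Sum>c\<in>\<C>. of_bool (c $ i = 0)) = real (card {c\<in>\<C>. c $ i = 0})"
      by (simp add: sum_of_bool_eq Int_def)
    ultimately show ?thesis by (simp add: sum_subtractf)
  qed
  show ?thesis unfolding weight_eq_sum by (subst sum.swap) (simp add: count)
qed

text \<open>Two coordinates that are linearly independent on the code attain the bound for a pair;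
  for proportional coordinates the count is larger.\<close>
lemma sum_weight_square_ge:
  fixes \<C> :: "('a::{field,finite} ^ 'n) set"
  assumes S: "vec.subspace \<C>" and nd: "nondegenerate \<C>"
  defines "N \<equiv> real (card \<C>)" and "q \<equiv> real CARD('a)" and "n \<equiv> real CARD('n)"
  shows "(\<Sum>c\<in>\<C>. (real (weight c))\<^sup>2) \<ge> n * (N - N / q) + n * (n - 1) * (N - 2 * N / q + N / q\<^sup>2)"
proof -
  \<comment> \<open>The squared weight of \<open>c\<close> counts ordered pairs of coordinates in
    its support, so the second moment is the sum of all \<open>h i j\<close>.\<close>
  define h where "h i j = (\<Sum>c\<in>\<C>. of_bool (c $ i \<noteq> 0) * of_bool (c $ j \<noteq> 0) :: real)" for i j
  have q: "q > 0" by (simp add: q_def)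
  have zeros: "real (card {c\<in>\<C>. c $ i = 0}) = N / q" for i
  proof -
    obtain b where "b \<in> \<C>" "b $ i \<noteq> 0" using nd by (auto simp: nondegenerate_def)
    from card_coordinate_zero[OF S this] show ?thesis by (simp add: N_def q_def)
  qed
  have sums: "(\<Sum>c\<in>\<C>. of_bool (P c)) = real (card {c\<in>\<C>. P c})" for P
    by (simp add: sum_of_bool_eq Int_def)
  have diag: "h i i = N - N / q" for i
  proof -
    have "h i i = (\<Sum>c\<in>\<C>. 1 - of_bool (c $ i = 0))"
      unfolding h_def by (intro sum.cong) auto
    then show ?thesis by (simp add: sum_subtractf sums zeros N_def)
  qed
  have off: "h i j \<ge> N - 2 * N / q + N / q\<^sup>2" for i j
  proof -
    \<comment> \<open>Inclusion-exclusion; only the number of common zeros has to be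
      estimated.\<close>
    have "h i j = (\<Sum>c\<in>\<C>. 1 - of_bool (c $ i = 0) - of_bool (c $ j = 0)
        + of_bool (c $ i = 0 \<and> c $ j = 0))"
      unfolding h_def by (intro sum.cong) auto
    also have "\<dots> = N - 2 * N / q + real (card {c\<in>\<C>. c $ i = 0 \<and> c $ j = 0})"
      unfolding sum.distrib sum_subtractf sums zeros by (simp add: N_def)
    finally have h: "h i j = \<dots>" .
    have "card {c\<in>\<C>. c $ i = 0} \<le> CARD('a) * card {c\<in>\<C>. c $ i = 0 \<and> c $ j = 0}"
      using card_coordinate_zero_ge[OF subspace_coordinate_zero[OF S], of i j] by simp
    then have "real (card {c\<in>\<C>. c $ i = 0})
        \<le> real (CARD('a) * card {c\<in>\<C>. c $ i = 0 \<and> c $ j = 0})"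
      by (rule of_nat_mono)
    then have "N / q \<le> real (card {c\<in>\<C>. c $ i = 0 \<and> c $ j = 0}) * q"
      unfolding zeros by (simp add: q_def mult.commute)
    then have "N / q / q \<le> real (card {c\<in>\<C>. c $ i = 0 \<and> c $ j = 0})"
      using q by (simp only: pos_divide_le_eq)
    then have "N / q\<^sup>2 \<le> real (card {c\<in>\<C>. c $ i = 0 \<and> c $ j = 0})"
      by (simp add: power2_eq_square)
    with h show ?thesis by simp
  qed
  have "(\<Sum>c\<in>\<C>. (real (weight c))\<^sup>2) = (\<Sum>i\<in>UNIV. \<Sum>j\<in>UNIV. h i j)"
  proof -
    have "(\<Sum>c\<in>\<C>. (real (weight c))\<^sup>2) =
        (\<Sum>c\<in>\<C>. \<Sum>i\<in>UNIV. \<Sum>j\<in>UNIV. of_bool (c $ i \<noteq> 0) * of_bool (c $ j \<noteq> 0))"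
      by (simp only: weight_eq_sum power2_eq_square sum_product)
    also have "\<dots> = (\<Sum>i\<in>UNIV. \<Sum>c\<in>\<C>. \<Sum>j\<in>UNIV. of_bool (c $ i \<noteq> 0) * of_bool (c $ j \<noteq> 0))"
      by (rule sum.swap)
    also have "\<dots> = (\<Sum>i\<in>UNIV. \<Sum>j\<in>UNIV. h i j)"
      unfolding h_def by (intro sum.cong refl sum.swap)
    finally show ?thesis .
  qed
  also have "\<dots> = (\<Sum>i\<in>UNIV. h i i + (\<Sum>j\<in>UNIV - {i}. h i j))"
    by (intro sum.cong refl sum.remove) auto
  also have "\<dots> \<ge> (\<Sum>i\<in>(UNIV::'n set). (N - N / q) + (\<Sum>j\<in>UNIV - {i}. N - 2 * N / q + N / q\<^sup>2))"
    using diag off by (intro sum_mono add_mono) auto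
  also have "(\<Sum>i\<in>(UNIV::'n set). (N - N / q) + (\<Sum>j\<in>UNIV - {i}. N - 2 * N / q + N / q\<^sup>2))
      = n * (N - N / q) + n * (n - 1) * (N - 2 * N / q + N / q\<^sup>2)"
  proof -
    have "(\<Sum>i\<in>(UNIV::'n set). a + (\<Sum>j\<in>UNIV - {i}. x)) = n * a + n * (n - 1) * x" for a x :: real
      by (simp add: n_def of_nat_diff algebra_simps)
    then show ?thesis .
  qed
  finally show ?thesis .
qed

section \<open>The minimum distance and the three inequalities\<close>

lemma min_distance_le:
  assumes "c \<in> \<C>" "c \<noteq> 0"
  shows "min_distance \<C> \<le> weight c"
  unfolding min_distance_def setcompr_eq_image
proof (rule Min_le)
  show "finite (weight ` {c. c \<in> \<C> \<and> c \<noteq> 0})" by (intro finite_imageI finite)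
  show "weight c \<in> weight ` {c. c \<in> \<C> \<and> c \<noteq> 0}" using assms by (intro imageI) simp
qed

lemma min_distance_attained:
  assumes "c \<in> \<C>" "c \<noteq> 0"
  obtains c' where "c' \<in> \<C>" "c' \<noteq> 0" "weight c' = min_distance \<C>"
proof -
  have "min_distance \<C> \<in> {weight c | c. c \<in> \<C> \<and> c \<noteq> 0}"
    unfolding min_distance_def using assms by (intro Min_in) auto
  then show ?thesis using that by auto
qed

theorem corollary3p7:
  fixes \<C> :: "('a::{field,finite} ^ 'n) set" and q n k d :: nat
  assumes "1 \<le> k" and "k \<le> n"
    and "linear_code q n k d \<C>"
    and "nondegenerate \<C>"
    and "minimal_code \<C>"
    and "\<not> constant_weight \<C>"
  shows "real n - real k + 1 > real n * (real q ^ k - real q ^ (k - 1)) / (real q ^ k - 1) \<and>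
    int d \<le> \<lfloor>real n * (real q - 1) * real q powi (int k - 2) * (real n - 1 - real q * (real k - 1))
              / (real n * (real q ^ (k - 1) - 1) - (real k - 1) * (real q ^ k - 1))\<rfloor> \<and>
    (let B = real q powi (int k - 2) + (real k - 1) * (2 * real q ^ (k - 1) - 1)
               + (real q ^ (k - 1) - 1) / (real q - 1);
         C = (real k - 1)^2 * (real q ^ k - 1) + (real k - 1) * (real q ^ k - 1) / (real q - 1)
     in real q powi (int k - 2) * real n ^ 2 - B * real n + C \<ge> 0)"
proof -
  have S: "vec.subspace \<C>" and dim: "vec.dim \<C> = k" and d: "d = min_distance \<C>"
    and q: "q = CARD('a)" and n: "n = CARD('n)"
    using assms(3) by (auto simp: linear_code_def)
  define x where "x = real q"
  \<comment> \<open>With \<open>Q\<close> every power of the field size in the claim becomes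
    \<open>Q\<close>, \<open>x * Q\<close> or \<open>x\<^sup>2 * Q\<close>; \<open>powi\<close>
    covers the exponent -1 at \<open>k = 1\<close>.\<close>
  define Q where "Q = x powi (int k - 2)"
  define M where "M = real n - real k + 1"
  define D where "D = real n * (x * Q - 1) - (real k - 1) * (x\<^sup>2 * Q - 1)"
  have x: "x \<ge> 2" using card_field_ge_2[where 'a='a] by (simp add: x_def q)
  have "x powi (int k - 2) * x powi 2 = x powi int k"
    using x by (subst power_int_add[symmetric]) auto
  then have xk: "x ^ k = x\<^sup>2 * Q" by (simp add: Q_def mult.commute)
  then have xk1: "x ^ (k - 1) = x * Q"
    using x \<open>1 \<le> k\<close> power_minus_mult[of k x] by (simp add: power2_eq_square)
  have card: "real (card \<C>) = x\<^sup>2 * Q"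
    by (simp add: card_subspace[OF S] dim x_def[unfolded q, symmetric] flip: xk)
  obtain c1 c2 where c12: "c1 \<in> \<C>" "c2 \<in> \<C>" "c1 \<noteq> 0" "c2 \<noteq> 0" "weight c1 < weight c2"
    using assms(6) unfolding constant_weight_def by (metis linorder_neqE_nat)
  have weight_le: "real (weight c) \<le> M" if "c \<in> \<C>" "c \<noteq> 0" for c
  proof -
    have "minimal_codeword \<C> c" using assms(5) that by (simp add: minimal_code_def)
    from weight_minimal_codeword_le[OF S this] show ?thesis
      by (simp add: M_def n dim)
  qed
  have d_le: "real d \<le> real (weight c)" if "c \<in> \<C>" "c \<noteq> 0" for c
    using min_distance_le[OF that] by (simp add: d)
  have zero: "0 \<in> \<C>" using S by (rule vec.subspace_0)
  have card0: "real (card (\<C> - {0})) = x\<^sup>2 * Q - 1"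
  proof -
    have "card \<C> > 0" using zero by (auto simp: card_gt_0_iff)
    then show ?thesis using zero by (simp add: card_Diff_singleton of_nat_diff flip: card)
  qed
  have w0: "weight (0 :: 'a ^ 'n) = 0" by (simp add: weight_def supp_def)
  have sum1: "(\<Sum>c\<in>\<C> - {0}. real (weight c)) = real n * (x\<^sup>2 * Q - x * Q)"
    using sum_weight[OF S assms(4)] zero w0 x card
    by (simp add: sum_diff1 n x_def[unfolded q, symmetric] power2_eq_square)
  have sum2: "(\<Sum>c\<in>\<C> - {0}. (real (weight c))\<^sup>2)
      \<ge> real n * (x\<^sup>2 * Q - x * Q) + real n * (real n - 1) * (x\<^sup>2 * Q - 2 * x * Q + Q)"
    using sum_weight_square_ge[OF S assms(4)] zero w0 x card
    by (simp add: sum_diff1 n x_def[unfolded q, symmetric] power2_eq_square mult.assoc)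
  have N: "x\<^sup>2 * Q - 1 > 0"
  proof -
    have "\<C> - {0} \<noteq> {}" using c12 by auto
    then have "card (\<C> - {0}) > 0" by (simp add: card_gt_0_iff)
    then show ?thesis by (simp flip: card0)
  qed
  have "(\<Sum>c\<in>\<C> - {0}. real (weight c)) < (\<Sum>c\<in>\<C> - {0}. M)"
  proof (rule sum_strict_mono_ex1)
    \<comment> \<open>\<open>c1\<close> is lighter than \<open>c2\<close>, whose weight is at most
      \<open>M\<close>; this makes the comparison of sums strict.\<close>
    have "real (weight c1) < M" using c12 weight_le[of c2] by linarith
    then show "\<exists>c\<in>\<C> - {0}. real (weight c) < M" using c12 by blast
  qed (use weight_le in auto)
  then have avg: "real n * (x\<^sup>2 * Q - x * Q) < M * (x\<^sup>2 * Q - 1)"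
    unfolding sum1 sum_constant card0 by (simp only: mult.commute)
  \<comment> \<open>\<open>D\<close> is the right side of \<open>avg\<close> minus the left, so the
    first inequality also makes the denominator of the second positive.\<close>
  then have D: "D > 0" by (simp add: D_def M_def algebra_simps)
  have "0 \<le> (\<Sum>c\<in>\<C> - {0}. (real (weight c) - real d) * (M - real (weight c)))"
    using weight_le d_le by (intro sum_nonneg mult_nonneg_nonneg) auto
  also have "\<dots> = (\<Sum>c\<in>\<C> - {0}. (M + real d) * real (weight c) - (real (weight c))\<^sup>2 - real d * M)"
    by (intro sum.cong) (auto simp: algebra_simps power2_eq_square)
  also have "\<dots> = (M + real d) * (real n * (x\<^sup>2 * Q - x * Q)) - (\<Sum>c\<in>\<C> - {0}. (real (weight c))\<^sup>2)
      - real d * M * (x\<^sup>2 * Q - 1)"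
    by (simp only: sum_subtractf sum_distrib_left[symmetric] sum1 sum_constant card0) (simp only: mult_ac)
  finally have "real d * M * (x\<^sup>2 * Q - 1) \<le> (M + real d) * (real n * (x\<^sup>2 * Q - x * Q))
      - (real n * (x\<^sup>2 * Q - x * Q) + real n * (real n - 1) * (x\<^sup>2 * Q - 2 * x * Q + Q))"
    using sum2 by linarith
  \<comment> \<open>Collecting the terms with \<open>real d\<close> gives the coefficient
    \<open>D\<close>. On the other side \<open>x\<^sup>2 * Q - 2 * x * Q + Q\<close> is
    \<open>Q\<close> times the square of \<open>x - 1\<close>, so
    \<open>real n * (x - 1) * Q\<close> factors out.\<close>
  then have bound: "real d * D \<le> real n * (x - 1) * Q * (real n - 1 - x * (real k - 1))"
    by (simp add: D_def M_def algebra_simps power2_eq_square)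
  obtain c where "c \<in> \<C>" "c \<noteq> 0" "weight c = d"
    using min_distance_attained[of c1 \<C>] c12 d by metis
  then have "(k - 1) * (q - 1) + 1 \<le> d"
    using weight_minimal_code_ge[OF S assms(5)] by (auto simp: dim q)
  then have "real ((k - 1) * (q - 1) + 1) \<le> real d" by (rule of_nat_mono)
  then have d_ge: "(real k - 1) * (x - 1) + 1 \<le> real d"
    using \<open>1 \<le> k\<close> x by (simp add: x_def of_nat_diff)
  have "((real k - 1) * (x - 1) + 1) * D \<le> real d * D"
    using d_ge D by (intro mult_right_mono) auto
  with bound have "((real k - 1) * (x - 1) + 1) * D
      \<le> real n * (x - 1) * Q * (real n - 1 - x * (real k - 1))" by linarith
  \<comment> \<open>Division by \<open>x - 1\<close> turns the factor in front of \<open>D\<close>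
    into \<open>real k - 1\<close> plus \<open>1 / (x - 1)\<close>; the second summand produces the
    fractions in \<open>B\<close> and \<open>C\<close>.\<close>
  then have quad: "0 \<le> (real n * (x - 1) * Q * (real n - 1 - x * (real k - 1))
      - ((real k - 1) * (x - 1) + 1) * D) / (x - 1)"
    using x by simp
  have "(real n * (x - 1) * Q * (real n - 1 - x * (real k - 1))
      - ((real k - 1) * (x - 1) + 1) * D) / (x - 1)
    = real n * Q * (real n - 1 - x * (real k - 1)) - (real k - 1) * D - D / (x - 1)"
    using x by (simp add: field_simps)
  also have "D / (x - 1) = real n * ((x * Q - 1) / (x - 1)) - (real k - 1) * (x\<^sup>2 * Q - 1) / (x - 1)"
    by (simp only: D_def diff_divide_distrib[of "real n * (x * Q - 1)"] times_divide_eq_right)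
  also have "real n * Q * (real n - 1 - x * (real k - 1)) - (real k - 1) * D
      - (real n * ((x * Q - 1) / (x - 1)) - (real k - 1) * (x\<^sup>2 * Q - 1) / (x - 1))
    = Q * (real n)\<^sup>2 - (Q + (real k - 1) * (2 * (x * Q) - 1) + (x * Q - 1) / (x - 1)) * real n
      + ((real k - 1)\<^sup>2 * (x\<^sup>2 * Q - 1) + (real k - 1) * (x\<^sup>2 * Q - 1) / (x - 1))"
  proof -
    \<comment> \<open>Abstracting the two fractions as \<open>s\<close> and \<open>t\<close> leaves
      an identity without division.\<close>
    have "real n * Q * (real n - 1 - x * (real k - 1)) - (real k - 1) * D - (real n * s - t)
      = Q * (real n)\<^sup>2 - (Q + (real k - 1) * (2 * (x * Q) - 1) + s) * real n
        + ((real k - 1)\<^sup>2 * (x\<^sup>2 * Q - 1) + t)" for s t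
      by (simp add: D_def algebra_simps power2_eq_square)
    then show ?thesis .
  qed
  finally have third: "0 \<le> Q * (real n)\<^sup>2
      - (Q + (real k - 1) * (2 * (x * Q) - 1) + (x * Q - 1) / (x - 1)) * real n
      + ((real k - 1)\<^sup>2 * (x\<^sup>2 * Q - 1) + (real k - 1) * (x\<^sup>2 * Q - 1) / (x - 1))"
    using quad by simp
  have first: "real n * (x\<^sup>2 * Q - x * Q) / (x\<^sup>2 * Q - 1) < M"
    using avg N by (simp add: pos_divide_less_eq)
  have "real d \<le> real n * (x - 1) * Q * (real n - 1 - x * (real k - 1)) / D"
    using bound D by (simp add: pos_le_divide_eq)
  then have second: "int d \<le> \<lfloor>real n * (x - 1) * Q * (real n - 1 - x * (real k - 1)) / D\<rfloor>"
    by (simp add: le_floor_iff)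
  show ?thesis
    using first second third
    unfolding Let_def x_def[symmetric] xk xk1 Q_def[symmetric] M_def D_def by simp
qed

end
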